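(* Let $\Omega$ be a commutative semigroup. (1) Let $(A,\{\,,\},(P_\omega)_{\omega\in\Omega})$ be a Rota-Baxter family Lie algebra of weight $0$. Define new operations on $A$ by $x\rhd_\omega y=\{P_\omega(x),y\}$ for $\omega\in\Omega$. Then $(A,(\rhd_\omega)_{\omega\in\Omega})$ is a left pre-Lie family algebra. (2) Let $(A,\cdot,(P_\omega)_{\omega\in\Omega})$ be a commutative Rota-Baxter family algebra of weight $0$. Define new operations on $A$ by $x\ast_\omega y=P_\omega(x)\cdot y$ for $\omega\in\Omega$. Then $(A,(\ast_\omega)_{\omega\in\Omega})$ is a left Zinbiel family algebra.
   Context: $\mathbf{k}$ is a unitary commutative ring, the base ring for all modules, algebras and linear maps. Algebras are unitary and associative. Rota-Baxter family algebra of weight $0$: an algebra $R$ with linear operators $(P_\omega)_{\omega\in\Omega}$ on $R$ such that $P_{\alpha}(a)P_{\beta}(b)=P_{\alpha\beta}\bigl( P_{\alpha}(a)b + a P_{\beta}(b)\bigr)$ for all $a,b\in R$, $\alpha,\beta\in\Omega$; it is commutative if $R$ is commutative. A Rota-Baxter family Lie algebra of weight $0$ is a Lie algebra $(A,\{\,,\})$ with linear operators $(P_\omega)_{\omega\in\Omega}$ such that $\{P_{\alpha}(x),P_{\beta}(y)\}=P_{\alpha\beta}\bigl(\{P_{\alpha}(x),y\}+\{x,P_{\beta}(y)\}\bigr)$ for all $x,y\in A$, $\alpha,\beta\in\Omega$. Left pre-Lie family algebra: a $\mathbf{k}$-module $A$ with bilinear operations $\rhd_\omega$, $\omega\in\Omega$,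 such that $x\rhd_\alpha(y\rhd_\beta z)-(x\rhd_\alpha y)\rhd_{\alpha\beta}z=y\rhd_\beta(x\rhd_\alpha z)-(y\rhd_\beta x)\rhd_{\beta\alpha}z$ for all $x,y,z\in A$, $\alpha,\beta\in\Omega$. Left Zinbiel family algebra: a $\mathbf{k}$-module $A$ with bilinear operations $\ast_\omega$, $\omega\in\Omega$, such that $x\ast_\alpha(y\ast_\beta z)=(x\ast_\alpha y)\ast_{\alpha\beta} z+(y\ast_\beta x)\ast_{\alpha\beta} z$ for all $x,y,z\in A$, $\alpha,\beta\in\Omega$. *)

theory Defs
  imports "HOL-Algebra.Module"
begin

text \<open>
  Everything is carrier-based, as in HOL-Algebra. The base ring is \<open>R\<close>, and the operators and
  operations of a family are functions of the index, constrained only for indices in \<open>W\<close>.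
  HOL-Algebra has no carrier-based semigroups.
\<close>

locale semigroup_on =
  fixes W :: "'w set" and mul :: "'w \<Rightarrow> 'w \<Rightarrow> 'w"
  assumes mul_closed: "\<lbrakk>\<alpha> \<in> W; \<beta> \<in> W\<rbrakk> \<Longrightarrow> mul \<alpha> \<beta> \<in> W"
    and mul_assoc: "\<lbrakk>\<alpha> \<in> W; \<beta> \<in> W; \<gamma> \<in> W\<rbrakk> \<Longrightarrow> mul (mul \<alpha> \<beta>) \<gamma> = mul \<alpha> (mul \<beta> \<gamma>)"

locale comm_semigroup_on = semigroup_on +
  assumes mul_comm: "\<lbrakk>\<alpha> \<in> W; \<beta> \<in> W\<rbrakk> \<Longrightarrow> mul \<alpha> \<beta> = mul \<beta> \<alpha>"

definition linear_operator ::
  "('r, 'm) ring_scheme \<Rightarrow> ('r, 'a, 'n) module_scheme \<Rightarrow> ('a \<Rightarrow> 'a) \<Rightarrow> bool" where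
  "linear_operator R A f \<longleftrightarrow>
     f \<in> carrier A \<rightarrow> carrier A \<and>
     (\<forall>x\<in>carrier A. \<forall>y\<in>carrier A. f (x \<oplus>\<^bsub>A\<^esub> y) = f x \<oplus>\<^bsub>A\<^esub> f y) \<and>
     (\<forall>c\<in>carrier R. \<forall>x\<in>carrier A. f (c \<odot>\<^bsub>A\<^esub> x) = c \<odot>\<^bsub>A\<^esub> f x)"

definition bilinear_operation ::
  "('r, 'm) ring_scheme \<Rightarrow> ('r, 'a, 'n) module_scheme \<Rightarrow> ('a \<Rightarrow> 'a \<Rightarrow> 'a) \<Rightarrow> bool" where
  "bilinear_operation R A f \<longleftrightarrow>
     (\<forall>x\<in>carrier A. linear_operator R A (\<lambda>y. f x y)) \<and>
     (\<forall>y\<in>carrier A. linear_operator R A (\<lambda>x. f x y))"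

text \<open>The library locale \<^locale>\<open>algebra\<close> only covers commutative algebras.\<close>

locale assoc_algebra = module R A + ring A
  for R (structure) and A (structure) +
  assumes mult_bilinear: "bilinear_operation R A (\<lambda>x y. x \<otimes>\<^bsub>A\<^esub> y)"

text \<open>
  HOL-Algebra modules are records extending rings. For Lie, pre-Lie and Zinbiel structures the
  multiplication and unit fields of \<open>A\<close> are unconstrained and unused.
\<close>

locale lie_algebra = module R A
  for R (structure) and A (structure) +
  fixes br :: "'c \<Rightarrow> 'c \<Rightarrow> 'c"
  assumes br_bilinear: "bilinear_operation R A br"
    and br_alternating: "x \<in> carrier A \<Longrightarrow> br x x = \<zero>\<^bsub>A\<^esub>"
    and br_jacobi: "\<lbrakk>x \<in> carrier A; y \<in> carrier A; z \<in> carrier A\<rbrakk> \<Longrightarrow>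
      br x (br y z) \<oplus>\<^bsub>A\<^esub> br y (br z x) \<oplus>\<^bsub>A\<^esub> br z (br x y) = \<zero>\<^bsub>A\<^esub>"

locale rota_baxter_family_algebra = assoc_algebra R A + semigroup_on W mul
  for R (structure) and A (structure) and W :: "'w set" and mul +
  fixes P :: "'w \<Rightarrow> 'c \<Rightarrow> 'c"
  assumes P_linear: "\<omega> \<in> W \<Longrightarrow> linear_operator R A (P \<omega>)"
    and rota_baxter: "\<lbrakk>a \<in> carrier A; b \<in> carrier A; \<alpha> \<in> W; \<beta> \<in> W\<rbrakk> \<Longrightarrow>
      P \<alpha> a \<otimes>\<^bsub>A\<^esub> P \<beta> b = P (mul \<alpha> \<beta>) (P \<alpha> a \<otimes>\<^bsub>A\<^esub> b \<oplus>\<^bsub>A\<^esub> a \<otimes>\<^bsub>A\<^esub> P \<beta> b)"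

locale comm_rota_baxter_family_algebra = rota_baxter_family_algebra R A W mul P + cring A
  for R (structure) and A (structure) and W mul P

locale rota_baxter_family_lie_algebra = lie_algebra R A br + semigroup_on W mul
  for R (structure) and A (structure) and br and W :: "'w set" and mul +
  fixes P :: "'w \<Rightarrow> 'c \<Rightarrow> 'c"
  assumes P_linear: "\<omega> \<in> W \<Longrightarrow> linear_operator R A (P \<omega>)"
    and rota_baxter: "\<lbrakk>x \<in> carrier A; y \<in> carrier A; \<alpha> \<in> W; \<beta> \<in> W\<rbrakk> \<Longrightarrow>
      br (P \<alpha> x) (P \<beta> y) = P (mul \<alpha> \<beta>) (br (P \<alpha> x) y \<oplus>\<^bsub>A\<^esub> br x (P \<beta> y))"

locale left_pre_lie_family_algebra = module R A + semigroup_on W mul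
  for R (structure) and A (structure) and W :: "'w set" and mul +
  fixes tri :: "'w \<Rightarrow> 'c \<Rightarrow> 'c \<Rightarrow> 'c"
  assumes tri_bilinear: "\<omega> \<in> W \<Longrightarrow> bilinear_operation R A (tri \<omega>)"
    and left_pre_lie:
      "\<lbrakk>x \<in> carrier A; y \<in> carrier A; z \<in> carrier A; \<alpha> \<in> W; \<beta> \<in> W\<rbrakk> \<Longrightarrow>
      tri \<alpha> x (tri \<beta> y z) \<ominus>\<^bsub>A\<^esub> tri (mul \<alpha> \<beta>) (tri \<alpha> x y) z =
      tri \<beta> y (tri \<alpha> x z) \<ominus>\<^bsub>A\<^esub> tri (mul \<beta> \<alpha>) (tri \<beta> y x) z"

locale left_zinbiel_family_algebra = module R A + semigroup_on W mul
  for R (structure) and A (structure) and W :: "'w set" and mul +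
  fixes ast :: "'w \<Rightarrow> 'c \<Rightarrow> 'c \<Rightarrow> 'c"
  assumes ast_bilinear: "\<omega> \<in> W \<Longrightarrow> bilinear_operation R A (ast \<omega>)"
    and left_zinbiel:
      "\<lbrakk>x \<in> carrier A; y \<in> carrier A; z \<in> carrier A; \<alpha> \<in> W; \<beta> \<in> W\<rbrakk> \<Longrightarrow>
      ast \<alpha> x (ast \<beta> y z) =
      ast (mul \<alpha> \<beta>) (ast \<alpha> x y) z \<oplus>\<^bsub>A\<^esub> ast (mul \<alpha> \<beta>) (ast \<beta> y x) z"

end

theory Submission
  imports Defs
begin

text \<open>
  Both identities come from expanding \<open>P\<^sub>\<alpha> x\<close> times \<open>P\<^sub>\<beta> y\<close>, acting on \<open>z\<close>, with the
  Rota-Baxter relation, after the Jacobi identity (in the form \<open>ad [a, b] = [ad a, ad b]\<close>),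
  respectively associativity, has produced that product. Antisymmetry, respectively
  commutativity, brings the second summand into the required order.
\<close>

lemma linear_operator_compose:
  assumes "linear_operator R A f" and "linear_operator R A g"
  shows "linear_operator R A (\<lambda>x. f (g x))"
  using assms unfolding linear_operator_def by (auto simp: Pi_iff)

text \<open>Both new operations have the form \<open>f (g x) y\<close>, with \<open>f\<close> the
  bracket or the product and \<open>g\<close> an operator of the family, so this settles bilinearity
  in both parts.\<close>

lemma bilinear_operation_compose_left:
  assumes "bilinear_operation R A f" and "linear_operator R A g"
  shows "bilinear_operation R A (\<lambda>x y. f (g x) y)"
  unfolding bilinear_operation_def
proof (intro conjI ballI)
  fix x
  assume "x \<in> carrier A"
  then have "g x \<in> carrier A"
    using assms(2) unfolding linear_operator_def by auto
  then show "linear_operator R A (\<lambda>y. f (g x) y)"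
    using assms(1) unfolding bilinear_operation_def by simp
next
  fix y
  assume "y \<in> carrier A"
  then have "linear_operator R A (\<lambda>x. f x y)"
    using assms(1) unfolding bilinear_operation_def by simp
  then show "linear_operator R A (\<lambda>x. f (g x) y)"
    using assms(2) by (rule linear_operator_compose)
qed

lemma linear_operator_closed:
  "\<lbrakk>linear_operator R A f; x \<in> carrier A\<rbrakk> \<Longrightarrow> f x \<in> carrier A"
  unfolding linear_operator_def by auto

lemma (in module) linear_operator_zero:
  assumes "linear_operator R M f"
  shows "f \<zero>\<^bsub>M\<^esub> = \<zero>\<^bsub>M\<^esub>"
proof -
  \<comment> \<open>Zero is the only idempotent of an abelian group, so it suffices that the image
    of zero is additively idempotent.\<close>
  have "f \<zero>\<^bsub>M\<^esub> \<oplus>\<^bsub>M\<^esub> f \<zero>\<^bsub>M\<^esub> = f \<zero>\<^bsub>M\<^esub>"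
    using assms unfolding linear_operator_def
    by (metis M.zero_closed M.l_zero)
  then show ?thesis
    using linear_operator_closed[OF assms M.zero_closed] by simp
qed

text \<open>Additivity makes the image of the inverse an inverse of the image, and inverses are
  unique. Signs are moved this way through the operators \<open>P \<omega>\<close> and through
  either argument of the bracket.\<close>

lemma (in module) linear_operator_minus:
  assumes f: "linear_operator R M f" and x: "x \<in> carrier M"
  shows "f (\<ominus>\<^bsub>M\<^esub> x) = \<ominus>\<^bsub>M\<^esub> f x"
proof -
  have "f (\<ominus>\<^bsub>M\<^esub> x) \<oplus>\<^bsub>M\<^esub> f x = f (\<ominus>\<^bsub>M\<^esub> x \<oplus>\<^bsub>M\<^esub> x)"
    using f x unfolding linear_operator_def by simp
  also have "\<dots> = \<zero>\<^bsub>M\<^esub>"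
    using x linear_operator_zero[OF f] by (simp add: M.l_neg)
  finally show ?thesis
    using x by (simp add: M.minus_equality linear_operator_closed[OF f])
qed

context lie_algebra
begin

lemma br_linear_right: "x \<in> carrier A \<Longrightarrow> linear_operator R A (br x)"
  using br_bilinear unfolding bilinear_operation_def by simp

lemma br_linear_left: "y \<in> carrier A \<Longrightarrow> linear_operator R A (\<lambda>x. br x y)"
  using br_bilinear unfolding bilinear_operation_def by simp

lemma br_closed: "\<lbrakk>x \<in> carrier A; y \<in> carrier A\<rbrakk> \<Longrightarrow> br x y \<in> carrier A"
  by (rule linear_operator_closed[OF br_linear_right])

lemma br_add_left:
  "\<lbrakk>x \<in> carrier A; y \<in> carrier A; z \<in> carrier A\<rbrakk> \<Longrightarrow>
    br (x \<oplus>\<^bsub>A\<^esub> y) z = br x z \<oplus>\<^bsub>A\<^esub> br y z"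
  using br_linear_left[of z] unfolding linear_operator_def by simp

lemma br_add_right:
  "\<lbrakk>x \<in> carrier A; y \<in> carrier A; z \<in> carrier A\<rbrakk> \<Longrightarrow>
    br x (y \<oplus>\<^bsub>A\<^esub> z) = br x y \<oplus>\<^bsub>A\<^esub> br x z"
  using br_linear_right[of x] unfolding linear_operator_def by simp

lemma br_minus_left:
  "\<lbrakk>x \<in> carrier A; y \<in> carrier A\<rbrakk> \<Longrightarrow> br (\<ominus>\<^bsub>A\<^esub> x) y = \<ominus>\<^bsub>A\<^esub> br x y"
  by (rule linear_operator_minus[OF br_linear_left])

lemma br_minus_right:
  "\<lbrakk>x \<in> carrier A; y \<in> carrier A\<rbrakk> \<Longrightarrow> br x (\<ominus>\<^bsub>A\<^esub> y) = \<ominus>\<^bsub>A\<^esub> br x y"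
  by (rule linear_operator_minus[OF br_linear_right])

text \<open>Polarization: the bracket of a sum with itself vanishes, and so do the two diagonal
  terms of its expansion, which leaves the sum of the mixed terms equal to zero.\<close>

lemma br_antisym:
  assumes x: "x \<in> carrier A" and y: "y \<in> carrier A"
  shows "br x y = \<ominus>\<^bsub>A\<^esub> br y x"
proof -
  have "\<zero>\<^bsub>A\<^esub> = br (x \<oplus>\<^bsub>A\<^esub> y) (x \<oplus>\<^bsub>A\<^esub> y)"
    using x y by (simp add: br_alternating)
  also have "\<dots> = (br x x \<oplus>\<^bsub>A\<^esub> br y x) \<oplus>\<^bsub>A\<^esub> (br x y \<oplus>\<^bsub>A\<^esub> br y y)"
    using x y by (simp add: br_add_left br_add_right br_closed)
  also have "\<dots> = br x y \<oplus>\<^bsub>A\<^esub> br y x"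
    using x y by (simp add: br_alternating br_closed M.a_comm)
  finally show ?thesis
    using x y by (simp add: M.minus_equality br_closed)
qed

text \<open>The Jacobi identity with two of its cyclic terms turned around by antisymmetry. This
  shape isolates \<open>br (br a b) z\<close>, whose inner bracket the Rota-Baxter relation can
  rewrite.\<close>

lemma br_br_left:
  assumes a: "a \<in> carrier A" and b: "b \<in> carrier A" and z: "z \<in> carrier A"
  shows "br a (br b z) = br (br a b) z \<oplus>\<^bsub>A\<^esub> br b (br a z)"
proof -
  have "br b (br z a) = \<ominus>\<^bsub>A\<^esub> br b (br a z)"
    using a b z by (simp add: br_antisym[of z a] br_minus_right br_closed)
  moreover have "br z (br a b) = \<ominus>\<^bsub>A\<^esub> br (br a b) z"
    using a b z by (intro br_antisym br_closed)
  ultimately have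
    "br a (br b z) \<oplus>\<^bsub>A\<^esub> (\<ominus>\<^bsub>A\<^esub> (br (br a b) z \<oplus>\<^bsub>A\<^esub> br b (br a z))) = \<zero>\<^bsub>A\<^esub>"
    using br_jacobi[OF a b z] a b z
    by (simp add: br_closed M.minus_add M.a_ac)
  \<comment> \<open>\<open>minus_equality\<close> reads a vanishing sum as a formula for the inverse
    of one summand. That summand is itself negated here, hence the double minus.\<close>
  then have "\<ominus>\<^bsub>A\<^esub> (\<ominus>\<^bsub>A\<^esub> (br (br a b) z \<oplus>\<^bsub>A\<^esub> br b (br a z))) = br a (br b z)"
    using a b z by (intro M.minus_equality) (simp_all add: br_closed)
  then show ?thesis
    using a b z by (simp add: br_closed)
qed

end

text \<open>Rearranged, the pre-Lie identity says that the commutator of the actions of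
  \<open>P \<alpha> x\<close> and \<open>P \<beta> y\<close> on \<open>z\<close> is the difference
  of the two subtracted terms.\<close>

lemma (in rota_baxter_family_lie_algebra) left_pre_lie_family_algebra:
  assumes "comm_semigroup_on W mul"
  shows "left_pre_lie_family_algebra R A W mul (\<lambda>\<omega> x y. br (P \<omega> x) y)"
proof unfold_locales
  fix \<omega>
  assume "\<omega> \<in> W"
  then show "bilinear_operation R A (\<lambda>x y. br (P \<omega> x) y)"
    by (rule bilinear_operation_compose_left[OF br_bilinear P_linear])
next
  fix x y z \<alpha> \<beta>
  assume x: "x \<in> carrier A" and y: "y \<in> carrier A" and z: "z \<in> carrier A"
    and \<alpha>: "\<alpha> \<in> W" and \<beta>: "\<beta> \<in> W"
  interpret comm_semigroup_on W mul by fact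
  define a b \<gamma> where "a = P \<alpha> x" and "b = P \<beta> y" and "\<gamma> = mul \<alpha> \<beta>"
  have a: "a \<in> carrier A" and b: "b \<in> carrier A"
    unfolding a_def b_def using x y \<alpha> \<beta> by (simp_all add: linear_operator_closed[OF P_linear])
  have P\<gamma>: "linear_operator R A (P \<gamma>)"
    unfolding \<gamma>_def using \<alpha> \<beta> by (intro P_linear mul_closed)
  \<comment> \<open>\<open>u\<close> is the term subtracted on the left of the pre-Lie identity;
    \<open>v\<close> is the one on the right, but written with the index
    \<open>mul \<alpha> \<beta>\<close>.\<close>
  define u v where "u = br (P \<gamma> (br a y)) z" and "v = br (P \<gamma> (br b x)) z"
  have u: "u \<in> carrier A" and v: "v \<in> carrier A"
    unfolding u_def v_def using a b x y z by (simp_all add: br_closed linear_operator_closed[OF P\<gamma>])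
  have "br a b = P \<gamma> (br a y \<oplus>\<^bsub>A\<^esub> br x b)"
    unfolding a_def b_def \<gamma>_def using x y \<alpha> \<beta> by (rule rota_baxter)
  \<comment> \<open>Antisymmetry puts \<open>b\<close> in front of \<open>x\<close>, and the
    resulting sign passes through \<open>P \<gamma>\<close>.\<close>
  also have "\<dots> = P \<gamma> (br a y) \<oplus>\<^bsub>A\<^esub> \<ominus>\<^bsub>A\<^esub> P \<gamma> (br b x)"
    using P\<gamma> a b x y linear_operator_minus[OF P\<gamma>]
    by (simp add: linear_operator_def br_closed br_antisym[of x b])
  finally have "br (br a b) z = u \<oplus>\<^bsub>A\<^esub> \<ominus>\<^bsub>A\<^esub> v"
    unfolding u_def v_def
    using a b x y z
    by (simp add: br_add_left br_minus_left br_closed linear_operator_closed[OF P\<gamma>])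
  then have "br a (br b z) \<ominus>\<^bsub>A\<^esub> u = u \<oplus>\<^bsub>A\<^esub> \<ominus>\<^bsub>A\<^esub> v \<oplus>\<^bsub>A\<^esub> br b (br a z) \<ominus>\<^bsub>A\<^esub> u"
    using br_br_left[OF a b z] by simp
  also have "\<dots> = br b (br a z) \<ominus>\<^bsub>A\<^esub> v"
    using a b z u v by (simp add: M.minus_eq M.a_ac M.r_neg2 br_closed)
  \<comment> \<open>Commutativity of the semigroup enters here: it replaces the index
    \<open>mul \<alpha> \<beta>\<close> of \<open>v\<close> by the required
    \<open>mul \<beta> \<alpha>\<close>.\<close>
  finally show "br (P \<alpha> x) (br (P \<beta> y) z) \<ominus>\<^bsub>A\<^esub> br (P (mul \<alpha> \<beta>) (br (P \<alpha> x) y)) z =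
      br (P \<beta> y) (br (P \<alpha> x) z) \<ominus>\<^bsub>A\<^esub> br (P (mul \<beta> \<alpha>) (br (P \<beta> y) x)) z"
    unfolding u_def v_def a_def b_def \<gamma>_def using mul_comm[OF \<alpha> \<beta>] by simp
qed

lemma (in comm_rota_baxter_family_algebra) left_zinbiel_family_algebra:
  "left_zinbiel_family_algebra R A W mul (\<lambda>\<omega> x y. P \<omega> x \<otimes>\<^bsub>A\<^esub> y)"
proof unfold_locales
  fix \<omega>
  assume "\<omega> \<in> W"
  then show "bilinear_operation R A (\<lambda>x y. P \<omega> x \<otimes>\<^bsub>A\<^esub> y)"
    by (rule bilinear_operation_compose_left[OF mult_bilinear P_linear])
next
  fix x y z \<alpha> \<beta>
  assume x: "x \<in> carrier A" and y: "y \<in> carrier A" and z: "z \<in> carrier A"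
    and \<alpha>: "\<alpha> \<in> W" and \<beta>: "\<beta> \<in> W"
  define \<gamma> where "\<gamma> = mul \<alpha> \<beta>"
  have a: "P \<alpha> x \<in> carrier A" and b: "P \<beta> y \<in> carrier A"
    using x y \<alpha> \<beta> by (simp_all add: linear_operator_closed[OF P_linear])
  have P\<gamma>: "linear_operator R A (P \<gamma>)"
    unfolding \<gamma>_def using \<alpha> \<beta> by (intro P_linear mul_closed)
  have "P \<alpha> x \<otimes>\<^bsub>A\<^esub> (P \<beta> y \<otimes>\<^bsub>A\<^esub> z) = P \<alpha> x \<otimes>\<^bsub>A\<^esub> P \<beta> y \<otimes>\<^bsub>A\<^esub> z"
    using a b z by (simp add: m_assoc)
  \<comment> \<open>The Rota-Baxter relation yields the summand with \<open>x\<close> on the left of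
    \<open>P \<beta> y\<close>; commutativity of the product swaps the factors, so that the
    operation with index \<open>\<beta>\<close> applied to \<open>y\<close> and \<open>x\<close>
    appears.\<close>
  also have "\<dots> = P \<gamma> (P \<alpha> x \<otimes>\<^bsub>A\<^esub> y \<oplus>\<^bsub>A\<^esub> P \<beta> y \<otimes>\<^bsub>A\<^esub> x) \<otimes>\<^bsub>A\<^esub> z"
    using rota_baxter[OF x y \<alpha> \<beta>] m_comm[OF x b] by (simp add: \<gamma>_def)
  also have "\<dots> = P \<gamma> (P \<alpha> x \<otimes>\<^bsub>A\<^esub> y) \<otimes>\<^bsub>A\<^esub> z \<oplus>\<^bsub>A\<^esub> P \<gamma> (P \<beta> y \<otimes>\<^bsub>A\<^esub> x) \<otimes>\<^bsub>A\<^esub> z"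
    using P\<gamma> a b x y z by (simp add: linear_operator_def l_distr Pi_iff)
  finally show "P \<alpha> x \<otimes>\<^bsub>A\<^esub> (P \<beta> y \<otimes>\<^bsub>A\<^esub> z) =
      P (mul \<alpha> \<beta>) (P \<alpha> x \<otimes>\<^bsub>A\<^esub> y) \<otimes>\<^bsub>A\<^esub> z \<oplus>\<^bsub>A\<^esub> P (mul \<alpha> \<beta>) (P \<beta> y \<otimes>\<^bsub>A\<^esub> x) \<otimes>\<^bsub>A\<^esub> z"
    unfolding \<gamma>_def .
qed

theorem proposition5p5:
  fixes R :: "('r, 'm) ring_scheme"
    and L :: "('r, 'l, 'n) module_scheme"
    and br :: "'l \<Rightarrow> 'l \<Rightarrow> 'l"
    and P :: "'w \<Rightarrow> 'l \<Rightarrow> 'l"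
    and A :: "('r, 'a, 'p) module_scheme"
    and Q :: "'w \<Rightarrow> 'a \<Rightarrow> 'a"
    and W :: "'w set"
    and mul :: "'w \<Rightarrow> 'w \<Rightarrow> 'w"
  assumes "comm_semigroup_on W mul"
  shows "(rota_baxter_family_lie_algebra R L br W mul P \<longrightarrow>
            left_pre_lie_family_algebra R L W mul (\<lambda>\<omega> x y. br (P \<omega> x) y)) \<and>
         (comm_rota_baxter_family_algebra R A W mul Q \<longrightarrow>
            left_zinbiel_family_algebra R A W mul (\<lambda>\<omega> x y. Q \<omega> x \<otimes>\<^bsub>A\<^esub> y))"
  by (intro conjI impI)
    (rule rota_baxter_family_lie_algebra.left_pre_lie_family_algebra[OF _ assms], assumption,
     rule comm_rota_baxter_family_algebra.left_zinbiel_family_algebra)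

end
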